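(* For each modal Heyting algebra $\mathbf{M}=\langle\mathbf{H},\Box,\Diamond\rangle$, the structure $\langle X(\mathbf{H}),\tau_{\mathbf{H}},\subseteq,\eta_\Box,\eta_\Diamond\rangle$ is a modal Esakia space.
   Context: A modal Heyting algebra is $\langle\mathbf{H},\Box,\Diamond\rangle$ with $\mathbf{H}$ a Heyting algebra and unary $\Box,\Diamond$ satisfying $\Box a\wedge\Diamond(-a\wedge b)=\bot$, where $-a=a\rightharpoonup\bot$. A Priestley space is a compact ordered space $\langle X,\tau,\le\rangle$ such that if $x\not\le y$ there is a clopen up-set containing $x$ but not $y$; an Esakia space is a Priestley space in which ${\downarrow}U$ is clopen for every clopen $U$. $\mathcal{U}(X)$, $\mathcal{D}(X)$ denote the clopen up-sets and clopen down-sets. $X(\mathbf{H})$ is the set of prime filters ordered by inclusion, $\sigma_{\mathbf{H}}(a)=\{P: a\in P\}$, and $\tau_{\mathbf{H}}$ is generated by the sets $\sigma_{\mathbf{H}}(a)$ and their complements. $\eta_\Box(P)=\{\sigma_{\mathbf{H}}(a): \Box a\in P\}$ and $\eta_\Diamond(P)=\mathcal{D}(X(\mathbf{H}))\setminus\{X(\mathbf{H})\setminus\sigma_{\mathbf{H}}(a): \Diamond a\in P\}$. A modal Esakia space is $\langle X,\tau,\le,\eta_1,\eta_2\rangle$ with $\langle X,\tau,\le\rangle$ an Esakia space and $\eta_1,\eta_2\colon X\to\mathcal{P}(\mathcal{P}(X))$ such that for all $x\in X$ and $U,V\in\mathcal{U}(X)$: (1) $\eta_1(x)\subseteq\mathcal{U}(X)$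 and $\eta_2(x)\subseteq\mathcal{D}(X)$; (2) $\Box_{\eta_1}(U)=\{x: U\in\eta_1(x)\}$ and $\Diamond_{\eta_2}(U)=\{x: X\setminus U\notin\eta_2(x)\}$ are clopen up-sets; (3) if $U\in\eta_1(x)$ then ${\downarrow}U\cup(X\setminus V)\in\eta_2(x)$. *)

theory Defs
  imports "HOL-Analysis.Analysis"
begin

class heyting_algebra = bounded_lattice +
  fixes himp :: "'a \<Rightarrow> 'a \<Rightarrow> 'a"  (infixr \<open>\<rightharpoonup>\<close> 60)
  assumes himp_adjoint: "inf a b \<le> c \<longleftrightarrow> a \<le> (b \<rightharpoonup> c)"
begin

definition hneg :: "'a \<Rightarrow> 'a"
  where "hneg a = (a \<rightharpoonup> bot)"

end

locale modal_heyting_algebra =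
  fixes nec pos :: "'a::heyting_algebra \<Rightarrow> 'a"
  assumes nec_inf_pos: "inf (nec a) (pos (inf (hneg a) b)) = bot"

text \<open>Spaces have an explicit carrier \<open>X\<close>, which is the whole space of the topology \<open>T\<close>.
  The order \<open>le\<close> and the neighbourhood maps are only relevant on \<open>X\<close>.\<close>

definition clopenin :: "'x topology \<Rightarrow> 'x set \<Rightarrow> bool"
  where "clopenin T U \<longleftrightarrow> openin T U \<and> closedin T U"

definition up_set :: "'x set \<Rightarrow> ('x \<Rightarrow> 'x \<Rightarrow> bool) \<Rightarrow> 'x set \<Rightarrow> bool"
  where "up_set X le U \<longleftrightarrow> U \<subseteq> X \<and> (\<forall>x\<in>U. \<forall>y\<in>X. le x y \<longrightarrow> y \<in> U)"

definition down_set :: "'x set \<Rightarrow> ('x \<Rightarrow> 'x \<Rightarrow> bool) \<Rightarrow> 'x set \<Rightarrow> bool"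
  where "down_set X le U \<longleftrightarrow> U \<subseteq> X \<and> (\<forall>x\<in>U. \<forall>y\<in>X. le y x \<longrightarrow> y \<in> U)"

definition down_closure :: "'x set \<Rightarrow> ('x \<Rightarrow> 'x \<Rightarrow> bool) \<Rightarrow> 'x set \<Rightarrow> 'x set"
  where "down_closure X le U = {x \<in> X. \<exists>y\<in>U. le x y}"

definition clopen_up_sets :: "'x set \<Rightarrow> 'x topology \<Rightarrow> ('x \<Rightarrow> 'x \<Rightarrow> bool) \<Rightarrow> 'x set set"
  where "clopen_up_sets X T le = {U. clopenin T U \<and> up_set X le U}"

definition clopen_down_sets :: "'x set \<Rightarrow> 'x topology \<Rightarrow> ('x \<Rightarrow> 'x \<Rightarrow> bool) \<Rightarrow> 'x set set"
  where "clopen_down_sets X T le = {U. clopenin T U \<and> down_set X le U}"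

locale priestley_space =
  fixes X :: "'x set" and T :: "'x topology" and le :: "'x \<Rightarrow> 'x \<Rightarrow> bool"
  assumes topspace_eq: "topspace T = X"
    and le_refl: "reflp_on X le"
    and le_trans: "transp_on X le"
    and le_antisym: "antisymp_on X le"
    and compact: "compact_space T"
    and separation: "\<lbrakk>x \<in> X; y \<in> X; \<not> le x y\<rbrakk> \<Longrightarrow> \<exists>U\<in>clopen_up_sets X T le. x \<in> U \<and> y \<notin> U"

locale esakia_space = priestley_space +
  assumes clopenin_down_closure: "clopenin T U \<Longrightarrow> clopenin T (down_closure X le U)"

definition nbhd_box :: "'x set \<Rightarrow> ('x \<Rightarrow> 'x set set) \<Rightarrow> 'x set \<Rightarrow> 'x set"
  where "nbhd_box X \<eta> U = {x \<in> X. U \<in> \<eta> x}"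

definition nbhd_dia :: "'x set \<Rightarrow> ('x \<Rightarrow> 'x set set) \<Rightarrow> 'x set \<Rightarrow> 'x set"
  where "nbhd_dia X \<eta> U = {x \<in> X. X - U \<notin> \<eta> x}"

locale modal_esakia_space = esakia_space X T le
  for X :: "'x set" and T :: "'x topology" and le :: "'x \<Rightarrow> 'x \<Rightarrow> bool" +
  fixes \<eta>\<^sub>1 \<eta>\<^sub>2 :: "'x \<Rightarrow> 'x set set"
  assumes nbhd1_up: "x \<in> X \<Longrightarrow> \<eta>\<^sub>1 x \<subseteq> clopen_up_sets X T le"
    and nbhd2_down: "x \<in> X \<Longrightarrow> \<eta>\<^sub>2 x \<subseteq> clopen_down_sets X T le"
    and nbhd_box_up: "U \<in> clopen_up_sets X T le \<Longrightarrow> nbhd_box X \<eta>\<^sub>1 U \<in> clopen_up_sets X T le"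
    and nbhd_dia_up: "U \<in> clopen_up_sets X T le \<Longrightarrow> nbhd_dia X \<eta>\<^sub>2 U \<in> clopen_up_sets X T le"
    and nbhd_compat: "\<lbrakk>x \<in> X; U \<in> clopen_up_sets X T le; V \<in> clopen_up_sets X T le; U \<in> \<eta>\<^sub>1 x\<rbrakk>
      \<Longrightarrow> down_closure X le U \<union> (X - V) \<in> \<eta>\<^sub>2 x"

definition lattice_filter :: "'a::bounded_lattice set \<Rightarrow> bool"
  where "lattice_filter F \<longleftrightarrow>
    F \<noteq> {} \<and> (\<forall>a\<in>F. \<forall>b. a \<le> b \<longrightarrow> b \<in> F) \<and> (\<forall>a\<in>F. \<forall>b\<in>F. inf a b \<in> F)"

definition prime_filter :: "'a::bounded_lattice set \<Rightarrow> bool"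
  where "prime_filter P \<longleftrightarrow>
    lattice_filter P \<and> P \<noteq> UNIV \<and> (\<forall>a b. sup a b \<in> P \<longrightarrow> a \<in> P \<or> b \<in> P)"

definition prime_filters :: "'a::bounded_lattice set set"
  where "prime_filters = {P. prime_filter P}"

definition stone_map :: "'a::bounded_lattice \<Rightarrow> 'a set set"
  where "stone_map a = {P \<in> prime_filters. a \<in> P}"

text \<open>The generators cover \<open>prime_filters\<close> because \<open>stone_map top = prime_filters\<close>, so this is a topology on
  \<open>prime_filters\<close>.\<close>

definition dual_topology :: "'a::bounded_lattice set topology"
  where "dual_topology =
    topology_generated_by (range stone_map \<union> range (\<lambda>a. prime_filters - stone_map a))"

definition eta_box :: "('a::bounded_lattice \<Rightarrow> 'a) \<Rightarrow> 'a set \<Rightarrow> 'a set set set"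
  where "eta_box nec P = {stone_map a | a. nec a \<in> P}"

definition eta_dia :: "('a::bounded_lattice \<Rightarrow> 'a) \<Rightarrow> 'a set \<Rightarrow> 'a set set set"
  where "eta_dia pos P =
    clopen_down_sets prime_filters dual_topology (\<subseteq>) - {prime_filters - stone_map a | a. pos a \<in> P}"

end

theory Submission
  imports Defs
begin

text \<open>
  A Heyting algebra is distributive, so a filter disjoint from an ideal extends to a prime filter
  that is still disjoint from it. Together with Alexander's subbase lemma this gives compactness.
  The same extension property shows that the down-closure of \<open>\<sigma>(a) - \<sigma>(b)\<close> is the complement
  of \<open>\<sigma>(a \<rightharpoonup> b)\<close>. As a clopen set is a finite union of such differences, its down-closure is the
  complement of some \<open>\<sigma>(c)\<close>. This yields the Esakia condition and, applied to the complement of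
  a clopen up-set, shows that the clopen up-sets are exactly the sets \<open>\<sigma>(c)\<close>. Since \<open>\<sigma>\<close> is injective,
  the neighbourhood operations on clopen up-sets correspond to the operations of the algebra, and
  the compatibility condition becomes the modal axiom because
  \<open>\<down>\<sigma>(a) \<union> (X - \<sigma>(b)) = X - \<sigma>(-a \<and> b)\<close>.
\<close>

section \<open>Filters, ideals and the prime filter theorem\<close>

lemma heyting_inf_sup_distrib:
  fixes a b c :: "'a::heyting_algebra"
  shows "inf a (sup b c) = sup (inf a b) (inf a c)"
proof (rule antisym)
  \<comment> \<open>Meeting with \<open>a\<close> is left adjoint to \<open>himp a\<close>, hence
    preserves joins: both joinands are moved across the adjunction, joined there and moved
    back.\<close>
  have "b \<le> a \<rightharpoonup> sup (inf a b) (inf a c)" "c \<le> a \<rightharpoonup> sup (inf a b) (inf a c)"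
    by (simp_all add: himp_adjoint [symmetric] inf.commute)
  then have "sup b c \<le> a \<rightharpoonup> sup (inf a b) (inf a c)"
    by simp
  then show "inf a (sup b c) \<le> sup (inf a b) (inf a c)"
    by (simp add: himp_adjoint [symmetric] inf.commute)
qed (rule distrib_inf_le)

text \<open>Order dual of \<open>lattice_filter\<close>. The improper ideal is included, since a set
  of elements may generate the whole lattice.\<close>

definition lattice_ideal :: "'a::bounded_lattice set \<Rightarrow> bool"
  where "lattice_ideal I \<longleftrightarrow>
    I \<noteq> {} \<and> (\<forall>a\<in>I. \<forall>b. b \<le> a \<longrightarrow> b \<in> I) \<and> (\<forall>a\<in>I. \<forall>b\<in>I. sup a b \<in> I)"

lemma lattice_filterD:
  assumes "lattice_filter F"
  shows "top \<in> F" "a \<in> F \<Longrightarrow> a \<le> b \<Longrightarrow> b \<in> F" "inf a b \<in> F \<longleftrightarrow> a \<in> F \<and> b \<in> F"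
  using assms unfolding lattice_filter_def
  by (auto intro: top_greatest inf_le1 inf_le2)

text \<open>The set is the filter generated by \<open>F\<close> and \<open>a\<close>, possibly
  improper. Witnesses \<open>m\<close> and \<open>n\<close> for two elements combine to
  \<open>inf m n\<close>.\<close>

lemma lattice_filter_adjoin:
  assumes F: "lattice_filter F"
  shows "lattice_filter {x. \<exists>m\<in>F. inf m a \<le> x}"
    and "F \<subseteq> {x. \<exists>m\<in>F. inf m a \<le> x}"
    and "a \<in> {x. \<exists>m\<in>F. inf m a \<le> x}"
proof -
  show sub: "F \<subseteq> {x. \<exists>m\<in>F. inf m a \<le> x}"
    by (auto intro: inf_le1)
  show "a \<in> {x. \<exists>m\<in>F. inf m a \<le> x}"
    using lattice_filterD(1) [OF F] by (auto intro: inf_le2)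
  have "\<exists>k\<in>F. inf k a \<le> inf x y" if "m \<in> F" "n \<in> F" "inf m a \<le> x" "inf n a \<le> y" for m n x y
  proof
    show "inf m n \<in> F"
      using that lattice_filterD(3) [OF F] by simp
    show "inf (inf m n) a \<le> inf x y"
      using that by (meson inf.boundedI inf.coboundedI1 inf.cobounded1 inf.cobounded2 inf_mono order_refl order_trans)
  qed
  then show "lattice_filter {x. \<exists>m\<in>F. inf m a \<le> x}"
    using sub lattice_filterD(1) [OF F] unfolding lattice_filter_def
    by (auto intro: order_trans)
qed

lemma lattice_filter_Union_chain:
  assumes "C \<noteq> {}" "\<And>F. F \<in> C \<Longrightarrow> lattice_filter F" "\<And>F G. F \<in> C \<Longrightarrow> G \<in> C \<Longrightarrow> F \<subseteq> G \<or> G \<subseteq> F"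
  shows "lattice_filter (\<Union>C)"
proof -
  have "inf a b \<in> \<Union>C" if "F \<in> C" "G \<in> C" "a \<in> F" "b \<in> G" for a b F G
    using assms(3) [OF that(1,2)] assms(2) that lattice_filterD(3) by blast
  moreover have "b \<in> \<Union>C" if "F \<in> C" "a \<in> F" "a \<le> b" for a b F
    using assms(2) that lattice_filterD(2) by blast
  moreover have "\<Union>C \<noteq> {}"
    using assms(1,2) lattice_filterD(1) by blast
  ultimately show ?thesis
    unfolding lattice_filter_def by blast
qed

text \<open>Zorn's lemma gives a filter \<open>M\<close> maximal among those that contain
  \<open>F\<close> and avoid \<open>I\<close>; maximality together with distributivity forces
  \<open>M\<close> to be prime.\<close>

theorem prime_filter_extension:
  fixes F I :: "'a::heyting_algebra set"
  assumes F: "lattice_filter F" and I: "lattice_ideal I" and disj: "F \<inter> I = {}"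
  obtains P where "P \<in> prime_filters" "F \<subseteq> P" "P \<inter> I = {}"
proof -
  let ?A = "{G. lattice_filter G \<and> F \<subseteq> G \<and> G \<inter> I = {}}"
  have "\<exists>M\<in>?A. \<forall>G\<in>?A. M \<subseteq> G \<longrightarrow> G = M"
  proof (rule subset_Zorn_nonempty)
    show "?A \<noteq> {}"
      using F disj by blast
    fix C
    assume C: "C \<noteq> {}" "subset.chain ?A C"
    then have "lattice_filter (\<Union>C)"
      by (intro lattice_filter_Union_chain) (auto simp: subset_chain_def)
    then show "\<Union>C \<in> ?A"
      using C by (auto simp: subset_chain_def)
  qed
  then obtain M where M: "lattice_filter M" "F \<subseteq> M" "M \<inter> I = {}"
    and max: "\<And>G. lattice_filter G \<Longrightarrow> M \<subseteq> G \<Longrightarrow> G \<inter> I = {} \<Longrightarrow> G = M"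
    by (smt (verit) mem_Collect_eq order_trans)
  \<comment> \<open>Maximality in usable form: the filter generated by \<open>M\<close> and
    \<open>a\<close> is strictly larger than \<open>M\<close>, so it hits \<open>I\<close>, and
    \<open>I\<close> is closed downwards.\<close>
  have meets: "\<exists>m\<in>M. inf m a \<in> I" if "a \<notin> M" for a
  proof -
    have "{x. \<exists>m\<in>M. inf m a \<le> x} \<inter> I \<noteq> {}"
      using max [OF lattice_filter_adjoin(1,2) [OF M(1)]] lattice_filter_adjoin(3) [OF M(1)] that
      by blast
    then show ?thesis
      using I unfolding lattice_ideal_def by blast
  qed
  have "a \<in> M \<or> b \<in> M" if ab: "sup a b \<in> M" for a b
  proof (rule ccontr)
    assume "\<not> ?thesis"
    then obtain m n where mn: "m \<in> M" "n \<in> M" "inf m a \<in> I" "inf n b \<in> I"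
      using meets by blast
    \<comment> \<open>A single element of \<open>M\<close> that serves for both \<open>a\<close> and
      \<open>b\<close>; by distributivity its meet with \<open>sup a b\<close> then lies in
      \<open>I\<close>.\<close>
    let ?k = "inf m n"
    have "inf ?k a \<in> I" "inf ?k b \<in> I"
      using mn(3,4) I unfolding lattice_ideal_def
      by (meson inf_mono inf_le1 inf_le2 order_refl)+
    then have "inf ?k (sup a b) \<in> I"
      using I unfolding lattice_ideal_def heyting_inf_sup_distrib by blast
    moreover have "inf ?k (sup a b) \<in> M"
      using ab mn M(1) by (simp add: lattice_filterD(1,3))
    ultimately show False
      using M(3) by blast
  qed
  moreover have "M \<noteq> UNIV"
    using M(3) I unfolding lattice_ideal_def by auto
  ultimately have "M \<in> prime_filters"
    using M(1) unfolding prime_filters_def prime_filter_def by blast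
  then show thesis
    using M that by blast
qed

text \<open>The filter generated by \<open>F\<close> and \<open>a\<close> avoids the principal ideal
  of \<open>b\<close>: otherwise \<open>inf m a \<le> b\<close> for some \<open>m\<close> in
  \<open>F\<close>, so \<open>m \<le> a \<rightharpoonup> b\<close> by adjointness and
  \<open>a \<rightharpoonup> b\<close> would be in \<open>F\<close>.\<close>

corollary prime_filter_separation:
  fixes a b :: "'a::heyting_algebra"
  assumes F: "lattice_filter F" and ab: "a \<rightharpoonup> b \<notin> F"
  obtains P where "P \<in> prime_filters" "F \<subseteq> P" "a \<in> P" "b \<notin> P"
proof -
  have disj: "{x. \<exists>m\<in>F. inf m a \<le> x} \<inter> {..b} = {}"
    using ab lattice_filterD(2) [OF F] himp_adjoint [of _ a b] by (force intro: order_trans)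
  have ideal: "lattice_ideal {..b}"
    unfolding lattice_ideal_def by (auto intro: order_trans)
  obtain P where "P \<in> prime_filters" "{x. \<exists>m\<in>F. inf m a \<le> x} \<subseteq> P" "P \<inter> {..b} = {}"
    by (rule prime_filter_extension [OF lattice_filter_adjoin(1) [OF F] ideal disj])
  then show thesis
    using that lattice_filter_adjoin(2,3) [OF F] by blast
qed

section \<open>The Stone map as a lattice embedding\<close>

lemma prime_filtersD:
  assumes "P \<in> prime_filters"
  shows "lattice_filter P" "bot \<notin> P" "sup a b \<in> P \<longleftrightarrow> a \<in> P \<or> b \<in> P"
proof -
  show P: "lattice_filter P"
    using assms by (simp add: prime_filters_def prime_filter_def)
  show "bot \<notin> P"
    using assms lattice_filterD(2) [OF P _ bot_least]
    by (auto simp: prime_filters_def prime_filter_def)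
  show "sup a b \<in> P \<longleftrightarrow> a \<in> P \<or> b \<in> P"
    using assms lattice_filterD(2) [OF P]
    by (auto simp: prime_filters_def prime_filter_def)
qed

lemma stone_map_subset: "stone_map a \<subseteq> prime_filters"
  by (auto simp: stone_map_def)

lemma stone_map_top: "stone_map top = prime_filters"
  by (auto simp: stone_map_def prime_filtersD lattice_filterD(1,3))

lemma stone_map_bot: "stone_map bot = {}"
  by (auto simp: stone_map_def prime_filtersD)

lemma stone_map_inf: "stone_map (inf a b) = stone_map a \<inter> stone_map b"
  by (auto simp: stone_map_def prime_filtersD lattice_filterD(1,3))

lemma stone_map_sup: "stone_map (sup a b) = stone_map a \<union> stone_map b"
  by (auto simp: stone_map_def prime_filtersD)

text \<open>If \<open>a \<le> b\<close> fails, then \<open>a \<rightharpoonup> b\<close> is not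
  \<open>top\<close>, and separation over the filter \<open>{top}\<close> yields a prime filter with
  \<open>a\<close> but without \<open>b\<close>.\<close>

lemma stone_map_subset_iff:
  fixes a b :: "'a::heyting_algebra"
  shows "stone_map a \<subseteq> stone_map b \<longleftrightarrow> a \<le> b"
proof
  assume sub: "stone_map a \<subseteq> stone_map b"
  show "a \<le> b"
  proof (rule ccontr)
    assume "\<not> a \<le> b"
    then have "a \<rightharpoonup> b \<notin> {top}"
      using himp_adjoint [of top a b] by auto
    moreover have "lattice_filter {top :: 'a}"
      by (auto simp: lattice_filter_def top_unique)
    ultimately show False
      using sub by (auto elim!: prime_filter_separation simp: stone_map_def)
  qed
next
  assume "a \<le> b"
  then show "stone_map a \<subseteq> stone_map b"
    by (auto simp: stone_map_def dest: prime_filtersD(1) lattice_filterD(2))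
qed

lemma inj_stone_map: "inj (stone_map :: 'a::heyting_algebra \<Rightarrow> 'a set set)"
  by (rule injI) (metis stone_map_subset_iff antisym order_refl)

lemma topspace_dual_topology: "topspace dual_topology = prime_filters"
  unfolding dual_topology_def topology_generated_by_topspace
  using stone_map_top stone_map_subset by auto

lemma openin_stone_map:
  shows "openin dual_topology (stone_map a)"
    and "openin dual_topology (prime_filters - stone_map a)"
  by (auto simp: dual_topology_def intro!: topology_generated_by_Basis)

lemma clopenin_stone_map:
  shows "clopenin dual_topology (stone_map a)"
    and "clopenin dual_topology (prime_filters - stone_map a)"
  using openin_stone_map [of a] stone_map_subset [of a]
  by (auto simp: clopenin_def closedin_def topspace_dual_topology double_diff)

lemma stone_map_clopen_up: "stone_map a \<in> clopen_up_sets prime_filters dual_topology (\<subseteq>)"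
  by (auto simp: clopen_up_sets_def clopenin_stone_map up_set_def) (auto simp: stone_map_def)

lemma stone_map_clopen_down:
  "prime_filters - stone_map a \<in> clopen_down_sets prime_filters dual_topology (\<subseteq>)"
  by (auto simp: clopen_down_sets_def clopenin_stone_map down_set_def) (auto simp: stone_map_def)

section \<open>Compactness of the dual topology\<close>

lemma lattice_filter_finite_meets:
  "lattice_filter {x. \<exists>B'. finite B' \<and> B' \<subseteq> B \<and> Inf_fin (insert top B') \<le> x}"
proof -
  \<comment> \<open>The filter generated by \<open>B\<close>. Inserting \<open>top\<close> keeps the
    argument of \<open>Inf_fin\<close> nonempty and gives the empty meet its proper value.\<close>
  let ?G = "{x. \<exists>B'. finite B' \<and> B' \<subseteq> B \<and> Inf_fin (insert top B') \<le> x}"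
  have "inf x y \<in> ?G" if x: "x \<in> ?G" and y: "y \<in> ?G" for x y
  proof -
    obtain B1 B2 where B: "finite B1" "B1 \<subseteq> B" "Inf_fin (insert top B1) \<le> x"
      "finite B2" "B2 \<subseteq> B" "Inf_fin (insert top B2) \<le> y"
      using x y by auto
    then have "Inf_fin (insert top (B1 \<union> B2)) \<le> x" "Inf_fin (insert top (B1 \<union> B2)) \<le> y"
      by (auto intro: order_trans [OF Inf_fin.subset_imp])
    then show ?thesis
      using B by (auto intro!: exI [of _ "B1 \<union> B2"])
  qed
  moreover have "top \<in> ?G"
    by (auto intro: exI [of _ "{}"])
  ultimately show ?thesis
    unfolding lattice_filter_def by (auto intro: order_trans)
qed

lemma lattice_ideal_finite_joins:
  "lattice_ideal {x. \<exists>A'. finite A' \<and> A' \<subseteq> A \<and> x \<le> Sup_fin (insert bot A')}"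
proof -
  let ?G = "{x. \<exists>A'. finite A' \<and> A' \<subseteq> A \<and> x \<le> Sup_fin (insert bot A')}"
  have "sup x y \<in> ?G" if x: "x \<in> ?G" and y: "y \<in> ?G" for x y
  proof -
    obtain A1 A2 where A: "finite A1" "A1 \<subseteq> A" "x \<le> Sup_fin (insert bot A1)"
      "finite A2" "A2 \<subseteq> A" "y \<le> Sup_fin (insert bot A2)"
      using x y by auto
    then have "x \<le> Sup_fin (insert bot (A1 \<union> A2))" "y \<le> Sup_fin (insert bot (A1 \<union> A2))"
      by (auto intro: order_trans [OF _ Sup_fin.subset_imp])
    then show ?thesis
      using A by (auto intro!: exI [of _ "A1 \<union> A2"])
  qed
  moreover have "bot \<in> ?G"
    by (auto intro: exI [of _ "{}"])
  ultimately show ?thesis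
    unfolding lattice_ideal_def by (auto intro: order_trans)
qed

lemma Inf_fin_mem_lattice_filter:
  assumes "lattice_filter F" "finite B" "B \<subseteq> F"
  shows "Inf_fin (insert top B) \<in> F"
  using assms(2,3)
proof (induction B rule: finite_induct)
  case empty
  then show ?case
    using assms(1) by (simp add: lattice_filterD(1,3))
next
  case (insert b B)
  then show ?case
    using assms(1) by (simp add: insert_commute [of top b] Inf_fin.insert lattice_filterD(1,3))
qed

lemma Sup_fin_mem_prime_filter:
  assumes "P \<in> prime_filters" "finite A" "Sup_fin (insert bot A) \<in> P"
  shows "\<exists>a\<in>A. a \<in> P"
  using assms(2,3)
proof (induction A rule: finite_induct)
  case empty
  then show ?case
    using assms(1) by (simp add: prime_filtersD)
next
  case (insert a A)
  then show ?case
    using assms(1) by (auto simp: insert_commute [of bot a] Sup_fin.insert prime_filtersD)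
qed

text \<open>Links the form of the topology in \<open>Alexander_subbase\<close> with the inductive
  one in \<open>dual_topology\<close>. Both make the members of \<open>\<B>\<close> open and both
  are coarsest with this property, so each contains the other.\<close>

lemma topology_subbase_eq_generated_by:
  "topology (arbitrary union_of (finite intersection_of (\<lambda>S. S \<in> \<B>) relative_to \<Union>\<B>)) =
    topology_generated_by \<B>" (is "?T = _")
proof -
  have "openin (topology_generated_by \<B>) U" if "openin ?T U" for U
  proof (rule minimal_topology_subbase [OF _ _ that])
    show "openin (topology_generated_by \<B>) (\<Union>\<B>)"
      by (metis openin_topspace topology_generated_by_topspace)
  qed (simp add: topology_generated_by_Basis)
  moreover have "openin ?T U" if "openin (topology_generated_by \<B>) U" for U
  proof (rule generate_topology_on_coarsest [OF _ _ openin_topology_generated_by [OF that]])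
    show "openin ?T S" if "S \<in> \<B>" for S
      using that unfolding openin_subbase
      by (metis Union_upper arbitrary_union_of_inc finite_intersection_of_inc relative_to_subset_inc)
  qed simp
  ultimately show ?thesis
    by (auto simp: topology_eq)
qed

text \<open>A cover by generators is split into the elements \<open>?pos\<close> and
  \<open>?neg\<close> that name its members. A prime filter containing \<open>?neg\<close> and
  avoiding \<open>?pos\<close> would be uncovered, so the filter generated by \<open>?neg\<close>
  meets the ideal generated by \<open>?pos\<close>. The finitely many elements witnessing this name
  a finite subcover.\<close>

theorem compact_dual_topology: "compact_space (dual_topology :: 'a::heyting_algebra set topology)"
proof (rule Alexander_subbase)
  let ?B = "range stone_map \<union> range (\<lambda>a. prime_filters - stone_map a) :: 'a set set set"
  show "topology (arbitrary union_of (finite intersection_of (\<lambda>S. S \<in> ?B)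
    relative_to \<Union>?B)) = dual_topology"
    unfolding dual_topology_def by (rule topology_subbase_eq_generated_by)
  fix C :: "'a set set set"
  assume C: "C \<subseteq> ?B" "\<Union>C = topspace dual_topology"
  let ?pos = "{a. stone_map a \<in> C}" and ?neg = "{b. prime_filters - stone_map b \<in> C}"
  let ?I = "{x. \<exists>A'. finite A' \<and> A' \<subseteq> ?pos \<and> x \<le> Sup_fin (insert bot A')}"
  let ?F = "{x. \<exists>B'. finite B' \<and> B' \<subseteq> ?neg \<and> Inf_fin (insert top B') \<le> x}"
  have "?F \<inter> ?I \<noteq> {}"
  proof
    assume "?F \<inter> ?I = {}"
    then obtain P where P: "P \<in> prime_filters" "?F \<subseteq> P" "P \<inter> ?I = {}"
      by (rule prime_filter_extension [OF lattice_filter_finite_meets lattice_ideal_finite_joins])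
    then obtain S where S: "S \<in> C" "P \<in> S"
      using C(2) topspace_dual_topology by blast
    then consider a where "S = stone_map a" | b where "S = prime_filters - stone_map b"
      using C(1) by blast
    then show False
    proof cases
      case 1
      then have "a \<in> ?I"
        using S by (auto intro!: exI [of _ "{a}"] simp: Sup_fin.insert)
      then show False
        using 1 S P(3) by (auto simp: stone_map_def)
    next
      case 2
      then have "b \<in> ?F"
        using S by (auto intro!: exI [of _ "{b}"] simp: Inf_fin.insert)
      then show False
        using 2 S P by (auto simp: stone_map_def)
    qed
  qed
  then obtain x A' B' where AB: "finite A'" "A' \<subseteq> ?pos" "finite B'" "B' \<subseteq> ?neg"
    and x: "Inf_fin (insert top B') \<le> x" "x \<le> Sup_fin (insert bot A')"
    by blast
  from x have le: "Inf_fin (insert top B') \<le> Sup_fin (insert bot A')"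
    by (rule order_trans)
  let ?C' = "stone_map ` A' \<union> (\<lambda>b. prime_filters - stone_map b) ` B'"
  \<comment> \<open>A prime filter missing some element of \<open>B'\<close> lies in the
    corresponding complement. One containing all of \<open>B'\<close> contains their meet, hence the
    join of \<open>A'\<close>, hence by primeness an element of \<open>A'\<close>.\<close>
  have "P \<in> \<Union>?C'" if P: "P \<in> prime_filters" for P
  proof (cases "B' \<subseteq> P")
    case True
    then have "Inf_fin (insert top B') \<in> P"
      using P AB(3) by (simp add: Inf_fin_mem_lattice_filter prime_filtersD)
    then have "Sup_fin (insert bot A') \<in> P"
      using lattice_filterD(2) [OF prime_filtersD(1) [OF P] _ le] by blast
    then show ?thesis
      using Sup_fin_mem_prime_filter [OF P AB(1)] P by (auto simp: stone_map_def)
  next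
    case False
    then show ?thesis
      using P by (auto simp: stone_map_def)
  qed
  then have "\<Union>?C' = topspace dual_topology"
    using stone_map_subset unfolding topspace_dual_topology by blast
  moreover have "finite ?C'" "?C' \<subseteq> C"
    using AB by auto
  ultimately show "\<exists>C'. finite C' \<and> C' \<subseteq> C \<and> \<Union>C' = topspace dual_topology"
    by blast
qed

section \<open>Basic open sets, down-closures and clopen up-sets\<close>

lemma openin_dual_topology_basis:
  assumes "openin dual_topology U" "P \<in> U"
  shows "\<exists>a b. P \<in> stone_map a - stone_map b \<and> stone_map a - stone_map b \<subseteq> U"
proof -
  have "generate_topology_on
      (range stone_map \<union> range (\<lambda>a. prime_filters - stone_map a)) U"
    using assms(1) by (simp add: dual_topology_def openin_topology_generated_by_iff)
  then show ?thesis
    using assms(2)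
  proof (induction rule: generate_topology_on.induct)
    case (Int U V)
    then obtain a b c d where "P \<in> stone_map a - stone_map b" "stone_map a - stone_map b \<subseteq> U"
      "P \<in> stone_map c - stone_map d" "stone_map c - stone_map d \<subseteq> V"
      by auto
    \<comment> \<open>Differences are closed under binary intersection, so the subbase yields a base
      of differences.\<close>
    then have "P \<in> stone_map (inf a c) - stone_map (sup b d)"
      "stone_map (inf a c) - stone_map (sup b d) \<subseteq> U \<inter> V"
      by (auto simp: stone_map_inf stone_map_sup)
    then show ?case
      by blast
  next
    case (UN K)
    then show ?case
      by (metis UnionE Union_upper subset_trans)
  next
    case (Basis S)
    then consider a where "S = stone_map a" | b where "S = prime_filters - stone_map b"
      by blast
    then show ?case
    proof cases
      \<comment> \<open>Generators are themselves differences: subtract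
        \<open>stone_map bot\<close>, which is empty, or subtract from \<open>stone_map top\<close>,
        which is the whole space.\<close>
      case 1
      then show ?thesis
        using Basis stone_map_bot by (metis Diff_empty order_refl)
    next
      case 2
      then show ?thesis
        using Basis stone_map_top by (metis order_refl)
    qed
  qed simp
qed

text \<open>One direction is modus ponens inside the larger filter \<open>Q\<close>; the other
  extends \<open>P\<close> to such a \<open>Q\<close> by
  \<open>prime_filter_separation\<close>.\<close>

lemma down_closure_diff_stone_map:
  fixes a b :: "'a::heyting_algebra"
  shows "down_closure prime_filters (\<subseteq>) (stone_map a - stone_map b) =
    prime_filters - stone_map (a \<rightharpoonup> b)"
proof -
  have "(\<exists>Q\<in>stone_map a - stone_map b. P \<subseteq> Q) \<longleftrightarrow> a \<rightharpoonup> b \<notin> P" if P: "P \<in> prime_filters" for P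
  proof
    assume "\<exists>Q\<in>stone_map a - stone_map b. P \<subseteq> Q"
    then obtain Q where Q: "Q \<in> prime_filters" "a \<in> Q" "b \<notin> Q" "P \<subseteq> Q"
      by (auto simp: stone_map_def)
    have "inf (a \<rightharpoonup> b) a \<le> b"
      by (simp add: himp_adjoint)
    then show "a \<rightharpoonup> b \<notin> P"
      using Q lattice_filterD(2,3) [OF prime_filtersD(1) [OF Q(1)]] by blast
  next
    assume "a \<rightharpoonup> b \<notin> P"
    then obtain Q where "Q \<in> prime_filters" "P \<subseteq> Q" "a \<in> Q" "b \<notin> Q"
      using prime_filter_separation [OF prime_filtersD(1) [OF P]] by metis
    then show "\<exists>Q\<in>stone_map a - stone_map b. P \<subseteq> Q"
      by (auto simp: stone_map_def)
  qed
  then show ?thesis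
    by (auto simp: down_closure_def stone_map_def)
qed

corollary down_closure_stone_map:
  "down_closure prime_filters (\<subseteq>) (stone_map a) = prime_filters - stone_map (hneg a)"
  using down_closure_diff_stone_map [of a bot] by (simp add: stone_map_bot hneg_def)

text \<open>Being open, \<open>U\<close> is a union of differences; being closed in a compact space,
  it needs only finitely many. Down-closure commutes with unions, and a union of complements of
  Stone sets is the complement of the Stone set of the meet.\<close>

lemma down_closure_clopenin:
  fixes U :: "'a::heyting_algebra set set"
  assumes "clopenin dual_topology U"
  obtains c where "down_closure prime_filters (\<subseteq>) U = prime_filters - stone_map c"
proof -
  let ?K = "{(a, b). stone_map a - stone_map b \<subseteq> U}"
  let ?D = "\<lambda>(a, b). stone_map a - stone_map b :: 'a set set"
  have "compactin dual_topology U"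
    using assms unfolding clopenin_def by (intro closedin_compact_space compact_dual_topology) simp
  moreover have "openin dual_topology S" if "S \<in> ?D ` ?K" for S
    using that clopenin_stone_map(1) unfolding clopenin_def by (auto intro: openin_diff)
  moreover have "U \<subseteq> \<Union>(?D ` ?K)"
  proof
    fix P
    assume "P \<in> U"
    then obtain a b where "P \<in> stone_map a - stone_map b" "stone_map a - stone_map b \<subseteq> U"
      using assms openin_dual_topology_basis unfolding clopenin_def by blast
    then show "P \<in> \<Union>(?D ` ?K)"
      by auto
  qed
  ultimately obtain L where L: "finite L" "L \<subseteq> ?D ` ?K" "U \<subseteq> \<Union>L"
    unfolding compactin_def by meson
  then have "U = \<Union>L"
    by auto
  moreover have "\<exists>c. down_closure prime_filters (\<subseteq>) (\<Union>L) = prime_filters - stone_map c"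
    using L(1,2)
  proof (induction L rule: finite_induct)
    \<comment> \<open>The empty union corresponds to the empty meet, \<open>top\<close>.\<close>
    case empty
    then show ?case
      by (auto simp: down_closure_def stone_map_top intro!: exI [of _ top])
  next
    case (insert S L)
    then obtain a b c where S: "S = stone_map a - stone_map b"
      and c: "down_closure prime_filters (\<subseteq>) (\<Union>L) = prime_filters - stone_map c"
      by auto
    have "down_closure prime_filters (\<subseteq>) (\<Union>(insert S L)) =
      down_closure prime_filters (\<subseteq>) S \<union> down_closure prime_filters (\<subseteq>) (\<Union>L)"
      by (auto simp: down_closure_def)
    also have "\<dots> = prime_filters - stone_map (inf (a \<rightharpoonup> b) c)"
      unfolding S c down_closure_diff_stone_map stone_map_inf by blast
    finally show ?case
      by blast
  qed
  ultimately show thesis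
    using that by blast
qed

theorem clopen_up_sets_dual_topology:
  "clopen_up_sets prime_filters dual_topology (\<subseteq>) = range (stone_map :: 'a::heyting_algebra \<Rightarrow> _)"
proof
  show "clopen_up_sets prime_filters dual_topology (\<subseteq>) \<subseteq> range (stone_map :: 'a \<Rightarrow> _)"
  proof
    fix U :: "'a set set"
    assume U: "U \<in> clopen_up_sets prime_filters dual_topology (\<subseteq>)"
    then have "clopenin dual_topology (prime_filters - U)"
      by (metis (no_types, lifting) clopen_up_sets_def clopenin_def closedin_def mem_Collect_eq
          openin_closedin_eq topspace_dual_topology)
    then obtain c where c: "down_closure prime_filters (\<subseteq>) (prime_filters - U) = prime_filters - stone_map c"
      using down_closure_clopenin by blast
    \<comment> \<open>The complement of an up-set is a down-set and so its own down-closure;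
      complementing again recovers \<open>U\<close>.\<close>
    have "down_closure prime_filters (\<subseteq>) (prime_filters - U) = prime_filters - U"
      using U by (auto simp: clopen_up_sets_def up_set_def down_closure_def)
    then have "U = stone_map c"
      using c U stone_map_subset [of c] by (auto simp: clopen_up_sets_def up_set_def)
    then show "U \<in> range stone_map"
      by blast
  qed
qed (use stone_map_clopen_up in blast)

section \<open>The Esakia space and the neighbourhood maps\<close>

theorem esakia_space_dual:
  "esakia_space (prime_filters :: 'a::heyting_algebra set set) dual_topology (\<subseteq>)"
proof
  fix P Q :: "'a set"
  assume PQ: "P \<in> prime_filters" "Q \<in> prime_filters" "\<not> P \<subseteq> Q"
  then obtain a where "P \<in> stone_map a" "Q \<notin> stone_map a"
    by (auto simp: stone_map_def)
  then show "\<exists>U\<in>clopen_up_sets prime_filters dual_topology (\<subseteq>). P \<in> U \<and> Q \<notin> U"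
    using stone_map_clopen_up by blast
next
  fix U :: "'a set set"
  assume "clopenin dual_topology U"
  then show "clopenin dual_topology (down_closure prime_filters (\<subseteq>) U)"
    by (metis down_closure_clopenin clopenin_stone_map(2))
qed (auto simp: topspace_dual_topology compact_dual_topology reflp_on_def transp_on_def antisymp_on_def)

text \<open>Injectivity of \<open>stone_map\<close> excludes that the set enters
  \<open>eta_box\<close> through an element other than \<open>a\<close>.\<close>

lemma stone_map_mem_eta_box:
  fixes nec :: "'a::heyting_algebra \<Rightarrow> 'a"
  shows "stone_map a \<in> eta_box nec P \<longleftrightarrow> nec a \<in> P"
  by (auto simp: eta_box_def inj_eq [OF inj_stone_map])

text \<open>The set is a clopen down-set, so only the subtraction in \<open>eta_dia\<close> can
  exclude it. Complements of Stone sets determine their element, so this happens exactly through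
  \<open>a\<close>.\<close>

lemma diff_stone_map_mem_eta_dia:
  fixes pos :: "'a::heyting_algebra \<Rightarrow> 'a"
  shows "prime_filters - stone_map a \<in> eta_dia pos P \<longleftrightarrow> pos a \<notin> P"
proof -
  have "a = b" if "prime_filters - stone_map a = prime_filters - stone_map b" for b
    using that stone_map_subset [of a] stone_map_subset [of b]
    by (metis double_diff injD inj_stone_map order_refl)
  then show ?thesis
    using stone_map_clopen_down [of a] by (auto simp: eta_dia_def)
qed

theorem theorem13:
  fixes nec pos :: "'a::heyting_algebra \<Rightarrow> 'a"
  assumes "modal_heyting_algebra nec pos"
  shows "modal_esakia_space (prime_filters :: 'a set set) dual_topology (\<subseteq>) (eta_box nec) (eta_dia pos)"
proof -
  interpret modal_heyting_algebra nec pos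
    by (fact assms)
  interpret esakia_space "prime_filters :: 'a set set" dual_topology "(\<subseteq>)"
    by (fact esakia_space_dual)
  show ?thesis
  proof
    fix P :: "'a set" and U V :: "'a set set"
    show "eta_box nec P \<subseteq> clopen_up_sets prime_filters dual_topology (\<subseteq>)"
      using stone_map_clopen_up by (auto simp: eta_box_def)
    show "eta_dia pos P \<subseteq> clopen_down_sets prime_filters dual_topology (\<subseteq>)"
      by (auto simp: eta_dia_def)
    assume "U \<in> clopen_up_sets prime_filters dual_topology (\<subseteq>)"
    then obtain a where U: "U = stone_map a"
      by (auto simp: clopen_up_sets_dual_topology)
    have "nbhd_box prime_filters (eta_box nec) U = stone_map (nec a)"
      by (auto simp: U nbhd_box_def stone_map_mem_eta_box) (auto simp: stone_map_def)
    then show "nbhd_box prime_filters (eta_box nec) U \<in> clopen_up_sets prime_filters dual_topology (\<subseteq>)"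
      by (simp add: stone_map_clopen_up)
    \<comment> \<open>The negation in \<open>nbhd_dia\<close> cancels the one hidden in the set
      difference of \<open>eta_dia\<close>.\<close>
    have "nbhd_dia prime_filters (eta_dia pos) U = stone_map (pos a)"
      by (auto simp: U nbhd_dia_def diff_stone_map_mem_eta_dia) (auto simp: stone_map_def)
    then show "nbhd_dia prime_filters (eta_dia pos) U \<in> clopen_up_sets prime_filters dual_topology (\<subseteq>)"
      by (simp add: stone_map_clopen_up)
    assume P: "P \<in> prime_filters" and "V \<in> clopen_up_sets prime_filters dual_topology (\<subseteq>)"
      and "U \<in> eta_box nec P"
    then obtain b where V: "V = stone_map b" and a: "nec a \<in> P"
      by (auto simp: clopen_up_sets_dual_topology U stone_map_mem_eta_box)
    \<comment> \<open>With \<open>nec a\<close> in \<open>P\<close>, membership would put the meet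
      of the two, which is \<open>bot\<close> by the modal axiom, into a prime filter.\<close>
    have "pos (inf (hneg a) b) \<notin> P"
      using a P nec_inf_pos [of a b] by (metis lattice_filterD(3) prime_filtersD(1,2))
    moreover have "down_closure prime_filters (\<subseteq>) U \<union> (prime_filters - V) =
      prime_filters - stone_map (inf (hneg a) b)"
      unfolding U V down_closure_stone_map stone_map_inf by blast
    ultimately show "down_closure prime_filters (\<subseteq>) U \<union> (prime_filters - V) \<in> eta_dia pos P"
      by (simp add: diff_stone_map_mem_eta_dia)
  qed
qed

end
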